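(* Let $\mu \in (0,1)$, $\phi > 0$, $u \ge 0$, and suppose that $Y$ has the four-parameter beta distribution ${\rm B4}(\mu, \phi, -u, 1+u)$, i.e. $Y$ has density $$f_{\rm (B4)}(y \mid \mu,\phi,-u,1+u) = f_{\rm (B)}\left(\frac{y+u}{1+2u} \,\Big|\, \mu,\phi\right)\frac{1}{1+2u}, \qquad y \in \mathbb{R}.$$ Then: 1. If $u = 0$, $Y$ has the beta density $f_{\rm (B)}(y \mid \mu,\phi)$. 2. If $\mu_* = \mathrm{E}(Y \mid \mu,\phi,u) \in \mathbb{R}$ and $\sigma_*^2 = \mathrm{var}(Y \mid \mu,\phi,u) \in (0,\infty)$ are held fixed as $u$ varies, then, as $u \to \infty$, $Y$ converges in distribution to $\mu_* + \sigma_* Z$, where $Z$ is a standard normal random variable. That is: fix $\mu_* \in \mathbb{R}$ and $\sigma_* \in (0,\infty)$, and for all sufficiently large $u$ let $Y_u \sim {\rm B4}(\mu_u,\phi_u,-u,1+u)$, where $\mu_u \in (0,1)$ and $\phi_u > 0$ are such that $\mathrm{E}(Y_u) = \mu_*$ and $\mathrm{var}(Y_u) = \sigma_*^2$; then $Y_u \to \mu_* + \sigma_* Z$ in distribution as $u \to \infty$.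
   Context: For $\mu \in (0,1)$ and $\phi > 0$, the beta density in the mean-precision parameterization is $$f_{\rm (B)}(y \mid \mu,\phi) = \frac{I(0<y<1)}{B(\mu\phi,(1-\mu)\phi)}\, y^{\mu\phi-1}(1-y)^{(1-\mu)\phi-1},$$ where $B(\cdot,\cdot)$ is the beta function and $I(A)$ is $1$ if $A$ is true and $0$ otherwise. The four-parameter beta distribution ${\rm B4}(\mu,\phi,u_1,u_2)$, with boundary parameters $u_1<u_2$, has density $$f_{\rm (B4)}(y\mid\mu,\phi,u_1,u_2) = f_{\rm (B)}\left(\frac{y-u_1}{u_2-u_1}\,\Big|\,\mu,\phi\right)\frac{1}{u_2-u_1}.$$ The case considered is that of symmetric exceedance $u = -u_1 = u_2 - 1$. *)

theory Defs
  imports "HOL-Probability.Probability"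
begin

definition beta_density :: "real \<Rightarrow> real \<Rightarrow> real \<Rightarrow> real" where
  "beta_density \<mu> \<phi> y =
     of_bool (0 < y \<and> y < 1) / Beta (\<mu> * \<phi>) ((1 - \<mu>) * \<phi>)
       * y powr (\<mu> * \<phi> - 1) * (1 - y) powr ((1 - \<mu>) * \<phi> - 1)"

definition beta4_density :: "real \<Rightarrow> real \<Rightarrow> real \<Rightarrow> real \<Rightarrow> real \<Rightarrow> real" where
  "beta4_density \<mu> \<phi> u1 u2 y =
     beta_density \<mu> \<phi> ((y - u1) / (u2 - u1)) * (1 / (u2 - u1))"

text \<open>
  The library's \<^const>\<open>weak_conv_m\<close> is restricted to sequences. The following is the same notion
  (convergence of distribution functions at every continuity point of the limit) along an
  arbitrary filter, for random variables that may live on different probability spaces.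
\<close>

definition conv_in_distribution ::
    "('i \<Rightarrow> 'a measure) \<Rightarrow> ('i \<Rightarrow> 'a \<Rightarrow> real) \<Rightarrow> 'b measure \<Rightarrow> ('b \<Rightarrow> real) \<Rightarrow> 'i filter \<Rightarrow> bool" where
  "conv_in_distribution M X N Y F \<longleftrightarrow>
     (\<forall>x. isCont (cdf (distr N borel Y)) x \<longrightarrow>
        ((\<lambda>i. cdf (distr (M i) borel (X i)) x) \<longlongrightarrow> cdf (distr N borel Y) x) F)"

lemma conv_in_distribution_sequentially:
  "conv_in_distribution M X N Y sequentially \<longleftrightarrow>
     weak_conv_m (\<lambda>n. distr (M n) borel (X n)) (distr N borel Y)"
  by (simp add: conv_in_distribution_def weak_conv_m_def weak_conv_def)

end

theory Submission
  imports Defs "HOL-Real_Asymp.Real_Asymp"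
begin

text \<open>
  Fixing the mean \<open>m\<close> and the variance \<open>\<sigma>\<^sup>2\<close> of \<open>B4(\<mu>, \<phi>, -u, 1 + u)\<close> forces, with \<open>p = u + m\<close>,
  \<open>q = 1 + u - m\<close> and \<open>s = p + q = 1 + 2u\<close>, that \<open>\<mu> = p / s\<close> and \<open>\<phi> = p q / \<sigma>\<^sup>2 - 1\<close>. Up to a constant
  factor, the density of the standardised variable is then
  \<open>(1 + \<sigma> t / p)\<close> to the power \<open>\<mu> \<phi> - 1\<close> times \<open>(1 - \<sigma> t / q)\<close> to the power \<open>(1 - \<mu>) \<phi> - 1\<close>,
  which tends pointwise to \<open>exp (- t\<^sup>2 / 2)\<close> and, by strong concavity of its logarithm on the support,
  is eventually below a fixed Gaussian. The distribution function is a ratio of two integrals of this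
  kernel, so dominated convergence in the numerator and the denominator gives the limit without any
  asymptotics of the beta function.
\<close>

section \<open>Moments of the beta density\<close>

lemma borel_measurable_beta_density [measurable]: "beta_density \<mu> \<phi> \<in> borel_measurable borel"
  unfolding beta_density_def [abs_def] by measurable

lemma beta_density_nonneg:
  assumes "0 < \<mu>" "\<mu> < 1" "0 < \<phi>"
  shows "0 \<le> beta_density \<mu> \<phi> y"
proof -
  have "0 < Beta (\<mu> * \<phi>) ((1 - \<mu>) * \<phi>)"
    unfolding Beta_def using assms by (intro divide_pos_pos mult_pos_pos Gamma_real_pos) (auto intro: add_pos_pos)
  then show ?thesis
    by (simp add: beta_density_def)
qed

lemma borel_measurable_beta4_density [measurable]:
  "beta4_density \<mu> \<phi> u1 u2 \<in> borel_measurable borel"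
  unfolding beta4_density_def [abs_def] by measurable

lemma beta4_density_nonneg:
  assumes "0 < \<mu>" "\<mu> < 1" "0 < \<phi>" "u1 < u2"
  shows "0 \<le> beta4_density \<mu> \<phi> u1 u2 y"
  using assms by (simp add: beta4_density_def beta_density_nonneg)

text \<open>The factor \<open>w ^ k\<close> only raises the first exponent by \<open>k\<close>, so
  each moment is again a beta integral. The cases \<open>k = 0, 1, 2\<close> give the mass, the mean
  and the second moment.\<close>

lemma has_bochner_integral_beta_density_power:
  assumes "0 < \<mu>" "\<mu> < 1" "0 < \<phi>"
  shows "has_bochner_integral lborel (\<lambda>w. beta_density \<mu> \<phi> w * w ^ k)
    (Beta (\<mu> * \<phi> + real k) ((1 - \<mu>) * \<phi>) / Beta (\<mu> * \<phi>) ((1 - \<mu>) * \<phi>))"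
proof -
  define a b where "a = \<mu> * \<phi>" and "b = (1 - \<mu>) * \<phi>"
  have ab: "0 < a" "0 < b" "0 < a + real k"
    using assms by (auto simp: a_def b_def intro: add_pos_nonneg)
  define f where "f w = indicator {0..1} w *\<^sub>R (w powr (a + real k - 1) * (1 - w) powr (b - 1))" for w :: real
  have "has_bochner_integral lborel f (Beta (a + real k) b)"
    using integrable_Beta[OF ab(3,2)] set_borel_integral_eq_integral(2)[OF integrable_Beta[OF ab(3,2)]]
      integral_unique[OF has_integral_Beta_real[OF ab(3,2)]]
    by (simp add: has_bochner_integral_iff set_integrable_def set_lebesgue_integral_def f_def [abs_def])
  then have "has_bochner_integral lborel (\<lambda>w. f w / Beta a b) (Beta (a + real k) b / Beta a b)"
    by (rule has_bochner_integral_divide_zero)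
  moreover have "f w / Beta a b = beta_density \<mu> \<phi> w * w ^ k" for w
  proof (cases "0 < w \<and> w < 1")
    case True
    then have "w powr (a + real k - 1) = w powr (a - 1) * w ^ k"
      by (simp add: powr_realpow [symmetric] powr_add [symmetric] algebra_simps)
    then show ?thesis
      using True by (simp add: f_def beta_density_def a_def b_def)
  next
    case False
    \<comment> \<open>The library integral lives on the closed interval, the density on the open
      one. They agree at the endpoints because \<open>0 powr x = 0\<close> for every
      exponent.\<close>
    then have "w = 0 \<or> w = 1 \<or> w \<notin> {0..1}"
      by auto
    then show ?thesis
      by (auto simp: f_def beta_density_def)
  qed
  ultimately show ?thesis
    by (simp add: a_def b_def)
qed

text \<open>The recurrence \<open>(a + b) * Beta (a + 1) b = a * Beta a b\<close>, applied at
  \<open>a\<close> and then at \<open>a + 1\<close>, makes the beta function cancel from both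
  moments.\<close>

lemma beta_density_moments:
  assumes "0 < \<mu>" "\<mu> < 1" "0 < \<phi>"
  shows "has_bochner_integral lborel (beta_density \<mu> \<phi>) 1"
    and "has_bochner_integral lborel (\<lambda>w. beta_density \<mu> \<phi> w * w) \<mu>"
    and "has_bochner_integral lborel (\<lambda>w. beta_density \<mu> \<phi> w * w\<^sup>2) (\<mu> * (\<mu> * \<phi> + 1) / (\<phi> + 1))"
proof -
  define a b where "a = \<mu> * \<phi>" and "b = (1 - \<mu>) * \<phi>"
  have ab: "0 < a" "0 < b" "a + b = \<phi>"
    using assms by (auto simp: a_def b_def algebra_simps)
  have pos: "0 < Beta a b"
    unfolding Beta_def using ab by (intro divide_pos_pos mult_pos_pos Gamma_real_pos) auto
  have nonpos: "x \<notin> \<int>\<^sub>\<le>\<^sub>0" if "0 < x" for x :: real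
    using that by (auto elim!: nonpos_Ints_cases)
  have B1: "Beta (a + 1) b = \<mu> * Beta a b"
    using Beta_plus1_left[OF nonpos[OF ab(1)], of b] ab(3) assms by (simp add: a_def)
  have "0 < a + 1"
    using ab by simp
  from Beta_plus1_left[OF nonpos[OF this], of b]
  have "(\<phi> + 1) * Beta (a + 2) b = (a + 1) * (\<mu> * Beta a b)"
    using ab(3) B1 by (simp add: add_ac)
  then have B2: "Beta (a + 2) b = \<mu> * (\<mu> * \<phi> + 1) / (\<phi> + 1) * Beta a b"
    using assms by (simp add: field_simps a_def)
  show "has_bochner_integral lborel (beta_density \<mu> \<phi>) 1"
    using has_bochner_integral_beta_density_power[OF assms, of 0] pos
    by (simp add: a_def b_def)
  show "has_bochner_integral lborel (\<lambda>w. beta_density \<mu> \<phi> w * w) \<mu>"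
    using has_bochner_integral_beta_density_power[OF assms, of 1] pos B1
    by (simp add: a_def b_def)
  show "has_bochner_integral lborel (\<lambda>w. beta_density \<mu> \<phi> w * w\<^sup>2) (\<mu> * (\<mu> * \<phi> + 1) / (\<phi> + 1))"
    using has_bochner_integral_beta_density_power[OF assms, of 2] pos B2
    by (simp add: a_def b_def)
qed

section \<open>Mean and variance of the four-parameter beta distribution\<close>

text \<open>Substituting \<open>y = u1 + (u2 - u1) * w\<close> returns to the unit interval; the
  Jacobian cancels the factor \<open>1 / (u2 - u1)\<close> of the density.\<close>

lemma expectation_beta4:
  fixes g :: "real \<Rightarrow> real"
  assumes "0 < \<mu>" "\<mu> < 1" "0 < \<phi>" "u1 < u2"
    and "distributed M lborel Y (beta4_density \<mu> \<phi> u1 u2)"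
    and [measurable]: "g \<in> borel_measurable borel"
  shows "(\<integral>\<omega>. g (Y \<omega>) \<partial>M) = (\<integral>w. beta_density \<mu> \<phi> w * g (u1 + (u2 - u1) * w) \<partial>lborel)"
proof -
  have "(\<integral>\<omega>. g (Y \<omega>) \<partial>M) = (\<integral>y. beta4_density \<mu> \<phi> u1 u2 y * g y \<partial>lborel)"
    using assms by (intro distributed_integral [symmetric]) (auto intro: beta4_density_nonneg)
  also have "\<dots> = (u2 - u1) * (\<integral>w. beta4_density \<mu> \<phi> u1 u2 (u1 + (u2 - u1) * w) * g (u1 + (u2 - u1) * w) \<partial>lborel)"
    using assms(4) by (subst lborel_integral_real_affine[where c = "u2 - u1" and t = u1]) auto
  also have "\<dots> = (\<integral>w. beta_density \<mu> \<phi> w * g (u1 + (u2 - u1) * w) \<partial>lborel)"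
    using assms(4) by (subst integral_mult_right_zero [symmetric]) (simp add: beta4_density_def)
  finally show ?thesis .
qed

lemma beta4_mean:
  assumes "0 < \<mu>" "\<mu> < 1" "0 < \<phi>" "u1 < u2"
    and "distributed M lborel Y (beta4_density \<mu> \<phi> u1 u2)"
  shows "(\<integral>\<omega>. Y \<omega> \<partial>M) = u1 + (u2 - u1) * \<mu>"
proof -
  have "has_bochner_integral lborel
      (\<lambda>w. beta_density \<mu> \<phi> w * u1 + beta_density \<mu> \<phi> w * w * (u2 - u1)) (1 * u1 + \<mu> * (u2 - u1))"
    using assms by (intro has_bochner_integral_add has_bochner_integral_mult_left beta_density_moments)
  then show ?thesis
    using expectation_beta4[OF assms, of "\<lambda>y. y"]
    by (simp add: has_bochner_integral_iff algebra_simps)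
qed

lemma beta4_variance:
  assumes "0 < \<mu>" "\<mu> < 1" "0 < \<phi>" "u1 < u2"
    and "distributed M lborel Y (beta4_density \<mu> \<phi> u1 u2)"
  shows "(\<integral>\<omega>. (Y \<omega> - (u1 + (u2 - u1) * \<mu>))\<^sup>2 \<partial>M) = (u2 - u1)\<^sup>2 * (\<mu> * (1 - \<mu>)) / (\<phi> + 1)"
proof -
  let ?b = "beta_density \<mu> \<phi>" and ?s = "u2 - u1"
  have I: "has_bochner_integral lborel
      (\<lambda>w. ?b w * w\<^sup>2 * ?s\<^sup>2 - ?b w * w * (2 * \<mu> * ?s\<^sup>2) + ?b w * (\<mu>\<^sup>2 * ?s\<^sup>2))
      (\<mu> * (\<mu> * \<phi> + 1) / (\<phi> + 1) * ?s\<^sup>2 - \<mu> * (2 * \<mu> * ?s\<^sup>2) + 1 * (\<mu>\<^sup>2 * ?s\<^sup>2))"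
    using assms
    by (intro has_bochner_integral_add has_bochner_integral_diff has_bochner_integral_mult_left
        beta_density_moments)
  have "(\<integral>\<omega>. (Y \<omega> - (u1 + ?s * \<mu>))\<^sup>2 \<partial>M) =
      (\<integral>w. ?b w * (u1 + ?s * w - (u1 + ?s * \<mu>))\<^sup>2 \<partial>lborel)"
    by (rule expectation_beta4[OF assms]) measurable
  also have "\<dots> = (\<integral>w. ?b w * w\<^sup>2 * ?s\<^sup>2 - ?b w * w * (2 * \<mu> * ?s\<^sup>2) + ?b w * (\<mu>\<^sup>2 * ?s\<^sup>2) \<partial>lborel)"
    by (intro Bochner_Integration.integral_cong refl) (simp add: power2_eq_square algebra_simps)
  also have "\<dots> = \<mu> * (\<mu> * \<phi> + 1) / (\<phi> + 1) * ?s\<^sup>2 - \<mu> * (2 * \<mu> * ?s\<^sup>2) + 1 * (\<mu>\<^sup>2 * ?s\<^sup>2)"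
    using I by (rule has_bochner_integral_integral_eq)
  also have "\<dots> = ?s\<^sup>2 * (\<mu> * (1 - \<mu>)) / (\<phi> + 1)"
    using assms(3) by (simp add: divide_simps) (simp add: power2_eq_square algebra_simps)
  finally show ?thesis .
qed

section \<open>The standardised kernel\<close>

text \<open>The parameters \<open>\<mu>\<close> and \<open>\<phi>\<close> are eliminated in favour
  of \<open>m\<close>, \<open>\<sigma>\<close> and \<open>u\<close>, so asymptotics in
  \<open>u\<close> concern one explicit function. For \<open>p, q > 0\<close> its value at
  \<open>t = 0\<close> is 1, so no beta function enters.\<close>

definition beta_kernel :: "real \<Rightarrow> real \<Rightarrow> real \<Rightarrow> real \<Rightarrow> real" where
  "beta_kernel m \<sigma> u t = (let p = u + m; q = 1 + u - m; \<phi> = p * q / \<sigma>\<^sup>2 - 1 in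
     of_bool (0 < p + \<sigma> * t \<and> \<sigma> * t < q) *
     ((1 + \<sigma> * t / p) powr (p / (1 + 2 * u) * \<phi> - 1) *
      (1 - \<sigma> * t / q) powr (q / (1 + 2 * u) * \<phi> - 1)))"

lemma borel_measurable_beta_kernel [measurable]: "beta_kernel m \<sigma> u \<in> borel_measurable borel"
  unfolding beta_kernel_def [abs_def] Let_def by measurable

lemma divide_mult_one_plus:
  fixes p s x :: "'a :: field"
  assumes "p \<noteq> 0"
  shows "p / s * (1 + x / p) = (p + x) / s"
  using assms by (simp add: distrib_left add_divide_distrib)

text \<open>The two moment equations are solved for \<open>\<mu>\<close> and \<open>\<phi>\<close>.
  The factor \<open>K\<close> does not depend on \<open>t\<close>; its value stays hidden because it
  later cancels in a quotient.\<close>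

lemma beta4_density_eq_beta_kernel:
  assumes p: "0 < u + m" and q: "0 < 1 + u - m" and "0 < \<sigma>"
    and \<mu>: "m = - u + (1 + 2 * u) * \<mu>"
    and \<phi>: "0 < \<phi>" "\<sigma>\<^sup>2 = (1 + 2 * u)\<^sup>2 * (\<mu> * (1 - \<mu>)) / (\<phi> + 1)"
  obtains K where "\<And>t. beta4_density \<mu> \<phi> (- u) (1 + u) (m + \<sigma> * t) = K * beta_kernel m \<sigma> u t"
proof -
  let ?s = "1 + 2 * u"
  have s: "0 < ?s" using p q by simp
  have \<mu>': "\<mu> = (u + m) / ?s" "1 - \<mu> = (1 + u - m) / ?s"
    using s \<mu> by (auto simp: field_simps)
  have "(u + m) * (1 + u - m) = ?s\<^sup>2 * (\<mu> * (1 - \<mu>))"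
    using s by (simp add: \<mu>'(2)) (simp add: \<mu>'(1) power2_eq_square)
  also have "\<dots> = \<sigma>\<^sup>2 * (\<phi> + 1)"
    using \<phi> by (simp add: field_simps)
  finally have \<phi>': "(u + m) * (1 + u - m) / \<sigma>\<^sup>2 - 1 = \<phi>"
    using assms(3) by (simp add: field_simps)
  define a b where "a = \<mu> * \<phi> - 1" and "b = (1 - \<mu>) * \<phi> - 1"
  \<comment> \<open>This is the density at the mean, that is, at \<open>t = 0\<close>.\<close>
  define K where "K = \<mu> powr a * (1 - \<mu>) powr b / Beta (\<mu> * \<phi>) ((1 - \<mu>) * \<phi>) / ?s"
  have "beta4_density \<mu> \<phi> (- u) (1 + u) (m + \<sigma> * t) = K * beta_kernel m \<sigma> u t" for t
  proof -
    define w where "w = (m + \<sigma> * t + u) / ?s"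
    have w: "w = \<mu> * (1 + \<sigma> * t / (u + m))" "1 - w = (1 - \<mu>) * (1 - \<sigma> * t / (1 + u - m))"
    proof -
      show "w = \<mu> * (1 + \<sigma> * t / (u + m))"
        using divide_mult_one_plus[of "u + m" ?s "\<sigma> * t"] p
        by (simp only: w_def \<mu>'(1)) (simp add: add_ac)
      have "1 - w = (1 + u - m + - (\<sigma> * t)) / ?s"
        using s by (simp add: w_def diff_divide_eq_iff)
      then show "1 - w = (1 - \<mu>) * (1 - \<sigma> * t / (1 + u - m))"
        unfolding \<mu>'(2) using divide_mult_one_plus[of "1 + u - m" ?s "- (\<sigma> * t)"] q
        by (simp del: times_divide_eq_left)
    qed
    have supp: "0 < w \<and> w < 1 \<longleftrightarrow> 0 < u + m + \<sigma> * t \<and> \<sigma> * t < 1 + u - m"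
      using s by (auto simp: w_def field_simps)
    have 1: "beta4_density \<mu> \<phi> (- u) (1 + u) (m + \<sigma> * t) =
        of_bool (0 < w \<and> w < 1) * (w powr a * (1 - w) powr b) / Beta (\<mu> * \<phi>) ((1 - \<mu>) * \<phi>) / ?s"
    proof -
      have "1 + u - - u = ?s" "(m + \<sigma> * t - - u) / ?s = w"
        by (simp_all add: w_def)
      then show ?thesis
        unfolding beta4_density_def beta_density_def by (simp only: a_def b_def) simp
    qed
    have 2: "beta_kernel m \<sigma> u t = of_bool (0 < w \<and> w < 1) *
        ((1 + \<sigma> * t / (u + m)) powr a * (1 - \<sigma> * t / (1 + u - m)) powr b)"
      unfolding beta_kernel_def Let_def \<phi>' supp a_def b_def \<mu>' [symmetric] ..
    show ?thesis
    proof (cases "0 < w \<and> w < 1")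
      case True
      have \<mu>01: "0 < \<mu>" "0 < 1 - \<mu>"
        unfolding \<mu>' using p q s by auto
      have "0 < 1 + \<sigma> * t / (u + m)" "0 < 1 - \<sigma> * t / (1 + u - m)"
        using True w \<mu>01 by (metis diff_gt_0_iff_gt zero_less_mult_pos)+
      then have "w powr a = \<mu> powr a * (1 + \<sigma> * t / (u + m)) powr a"
          "(1 - w) powr b = (1 - \<mu>) powr b * (1 - \<sigma> * t / (1 + u - m)) powr b"
        unfolding w(2) using \<mu>01 by (simp_all add: powr_mult w(1))
      then show ?thesis
        unfolding 1 2 K_def by simp
    next
      case False
      then show ?thesis
        unfolding 1 2 by auto
    qed
  qed
  then show ?thesis
    by (rule that)
qed

section \<open>Pointwise limit and Gaussian domination of the kernel\<close>

text \<open>Both exponents grow like \<open>u^2 / (2 * \<sigma>^2)\<close>. In the logarithm the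
  linear terms combine to \<open>\<sigma> * t * (1 / q - 1 / p)\<close>, which vanishes in the
  limit; each quadratic term tends to \<open>- t^2 / 4\<close>; the higher terms are O(1/u).\<close>

lemma tendsto_beta_kernel:
  fixes m \<sigma> t :: real
  assumes "0 < \<sigma>"
  shows "((\<lambda>u. beta_kernel m \<sigma> u t) \<longlongrightarrow> exp (- t\<^sup>2 / 2)) at_top"
proof -
  define L where "L u = ((u + m) / (1 + 2 * u) * ((u + m) * (1 + u - m) / \<sigma>\<^sup>2 - 1) - 1) * ln (1 + \<sigma> * t / (u + m))
     + ((1 + u - m) / (1 + 2 * u) * ((u + m) * (1 + u - m) / \<sigma>\<^sup>2 - 1) - 1) * ln (1 - \<sigma> * t / (1 + u - m))" for u
  \<comment> \<open>The expansion is carried out separately for each sign of \<open>t\<close>; at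
    \<open>t = 0\<close> both logarithms vanish.\<close>
  have "t = 0 \<or> 0 < t \<or> t < 0"
    by auto
  then have "(L \<longlongrightarrow> - t\<^sup>2 / 2) at_top"
    unfolding L_def [abs_def] using assms
    by (elim disjE) (simp, (real_asymp simp: field_simps power2_eq_square)+)
  then have "((\<lambda>u. exp (L u)) \<longlongrightarrow> exp (- t\<^sup>2 / 2)) at_top"
    by (rule tendsto_exp)
  moreover have "\<forall>\<^sub>F u in at_top. exp (L u) = beta_kernel m \<sigma> u t"
    \<comment> \<open>Beyond this bound \<open>p\<close> and \<open>q\<close> are positive and the
      fixed \<open>t\<close> lies in the support.\<close>
    using eventually_gt_at_top[of "\<bar>m\<bar> + 1 + \<bar>\<sigma> * t\<bar>"]
  proof eventually_elim
    case (elim u)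
    then have pq: "0 < u + m" "0 < 1 + u - m"
      and supp: "0 < u + m + \<sigma> * t" "\<sigma> * t < 1 + u - m"
      by linarith+
    then have "0 < 1 + \<sigma> * t / (u + m)" "0 < 1 - \<sigma> * t / (1 + u - m)"
      by (simp_all add: field_simps)
    then show ?case
      using supp by (simp add: beta_kernel_def Let_def L_def powr_def exp_add)
  qed
  ultimately show ?thesis
    by (rule Lim_transform_eventually)
qed

text \<open>
  On \<open>(0, 1]\<close> the function \<open>ln w + w\<^sup>2 / 2\<close> is concave; the lemma is its tangent inequality at \<open>m\<close>. The
  quadratic term is what yields a Gaussian bound on the whole support.
\<close>

lemma ln_le_tangent_quadratic:
  fixes m w :: real
  assumes "0 < m" "m < 1" "0 < w" "w < 1"
  shows "ln w - ln m \<le> (w - m) / m - (w - m)\<^sup>2 / 2"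
proof -
  let ?f = "\<lambda>w::real. - ln w - w\<^sup>2 / 2" and ?f' = "\<lambda>w::real. - (1 / w) - w"
  have "convex_on {0<..<1} ?f"
  proof (rule f''_ge0_imp_convex)
    fix x :: real assume x: "x \<in> {0<..<1}"
    show "(?f has_real_derivative ?f' x) (at x)"
      using x by (auto intro!: derivative_eq_intros)
    show "(?f' has_real_derivative 1 / x\<^sup>2 - 1) (at x)"
      using x by (auto intro!: derivative_eq_intros simp: power2_eq_square)
    show "0 \<le> 1 / x\<^sup>2 - 1"
      using x by (simp add: power_le_one)
  qed simp
  then have "?f w - ?f m \<ge> ?f' m * (w - m)"
    by (rule convex_on_imp_above_tangent)
      (use assms in \<open>auto intro!: derivative_eq_intros simp: interior_open\<close>)
  then show ?thesis
    using assms(1) by (simp add: field_simps power2_eq_square)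
qed

text \<open>The tangent inequality is used at \<open>p / s\<close> and at \<open>q / s\<close> with
  \<open>s = 1 + 2 * u\<close>, weighted by the two exponents. The hypotheses make these weights
  nonnegative, bound the residual linear coefficient by 1 and bound the quadratic one below by
  \<open>1 / 16\<close>.\<close>

lemma beta_kernel_le:
  fixes m \<sigma> u t :: real
  defines "p \<equiv> u + m" and "q \<equiv> 1 + u - m"
  defines "\<phi> \<equiv> p * q / \<sigma>\<^sup>2 - 1"
  assumes "0 < p" "0 < q" "1 \<le> p / (1 + 2 * u) * \<phi>" "1 \<le> q / (1 + 2 * u) * \<phi>"
    and lin: "\<bar>\<sigma> * (1 / q - 1 / p)\<bar> \<le> 1"
    and quad: "1 / 16 \<le> (\<phi> - 2) * \<sigma>\<^sup>2 / (2 * (1 + 2 * u)\<^sup>2)"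
  shows "beta_kernel m \<sigma> u t \<le> exp 8 * exp (- t\<^sup>2 / 32)"
proof (cases "0 < p + \<sigma> * t \<and> \<sigma> * t < q")
  case True
  let ?s = "1 + 2 * u"
  have pq: "p + q = ?s" and s: "0 < ?s"
    using assms(4,5) by (auto simp: p_def q_def)
  \<comment> \<open>\<open>z\<close> is the deviation from the mean in the unit-interval coordinate;
    the second factor sees it as \<open>- z\<close>.\<close>
  define a b z where "a = p / ?s * \<phi> - 1" and "b = q / ?s * \<phi> - 1" and "z = \<sigma> * t / ?s"
  have ab: "0 \<le> a" "0 \<le> b"
    using assms by (auto simp: a_def b_def)
  have pos: "0 < 1 + \<sigma> * t / p" "0 < 1 - \<sigma> * t / q"
    using True assms(4,5) by (auto simp: field_simps)
  have ln_p: "ln (1 + \<sigma> * t / p) \<le> \<sigma> * t / p - z\<^sup>2 / 2"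
  proof -
    have "0 < p / ?s" "p / ?s < 1" "0 < (p + \<sigma> * t) / ?s" "(p + \<sigma> * t) / ?s < 1"
      using True assms(4,5) s pq by auto
    note ln_le_tangent_quadratic[OF this]
    moreover have "(p + \<sigma> * t) / ?s - p / ?s = z"
      by (simp add: z_def add_divide_distrib)
    moreover have "z / (p / ?s) = \<sigma> * t / p"
      using s by (simp add: z_def)
    moreover have "ln ((p + \<sigma> * t) / ?s) - ln (p / ?s) = ln (1 + \<sigma> * t / p)"
      using assms(4) s pos(1) divide_mult_one_plus[of p ?s "\<sigma> * t"]
        ln_mult_pos[of "p / ?s" "1 + \<sigma> * t / p"] by simp
    ultimately show ?thesis
      by (simp only:)
  qed
  have ln_q: "ln (1 - \<sigma> * t / q) \<le> - (\<sigma> * t / q) - z\<^sup>2 / 2"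
  proof -
    have "0 < q / ?s" "q / ?s < 1" "0 < (q - \<sigma> * t) / ?s" "(q - \<sigma> * t) / ?s < 1"
      using True assms(4,5) s pq by auto
    note ln_le_tangent_quadratic[OF this]
    moreover have "(q - \<sigma> * t) / ?s - q / ?s = - z"
      by (simp add: z_def diff_divide_distrib)
    moreover have "- z / (q / ?s) = - (\<sigma> * t / q)"
      using s by (simp add: z_def)
    moreover have "ln ((q - \<sigma> * t) / ?s) - ln (q / ?s) = ln (1 - \<sigma> * t / q)"
      using assms(5) s pos(2) divide_mult_one_plus[of q ?s "- (\<sigma> * t)"]
        ln_mult_pos[of "q / ?s" "1 - \<sigma> * t / q"] by simp
    ultimately show ?thesis
      by (simp only: power2_minus)
  qed
  \<comment> \<open>The large term \<open>\<phi> / s\<close> is common to both quotients, so only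
    \<open>1 / q - 1 / p\<close> survives in the linear coefficient.\<close>
  have ap: "a / p = \<phi> / ?s - 1 / p" and bq: "b / q = \<phi> / ?s - 1 / q"
    using assms(4,5) by (auto simp: a_def b_def diff_divide_distrib)
  have ab_sum: "a + b = \<phi> - 2"
  proof -
    have "a + b = (p + q) / ?s * \<phi> - 2"
      by (simp add: a_def b_def add_divide_distrib algebra_simps)
    then show ?thesis using pq s by simp
  qed
  have "a * ln (1 + \<sigma> * t / p) + b * ln (1 - \<sigma> * t / q)
      \<le> a * (\<sigma> * t / p - z\<^sup>2 / 2) + b * (- (\<sigma> * t / q) - z\<^sup>2 / 2)"
    using ab ln_p ln_q by (intro add_mono mult_left_mono) auto
  also have "\<dots> = \<sigma> * t * (a / p - b / q) - (a + b) * (z\<^sup>2 / 2)"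
    by (simp add: algebra_simps)
  also have "\<dots> = \<sigma> * (1 / q - 1 / p) * t - (\<phi> - 2) * \<sigma>\<^sup>2 / (2 * ?s\<^sup>2) * t\<^sup>2"
    unfolding ap bq ab_sum by (simp add: z_def power_divide power_mult_distrib algebra_simps)
  also have "\<dots> \<le> \<bar>t\<bar> - 1 / 16 * t\<^sup>2"
  proof (rule diff_mono)
    have "\<sigma> * (1 / q - 1 / p) * t \<le> \<bar>\<sigma> * (1 / q - 1 / p)\<bar> * \<bar>t\<bar>"
      by (metis abs_ge_self abs_mult)
    also have "\<dots> \<le> 1 * \<bar>t\<bar>"
      using lin by (intro mult_right_mono) auto
    finally show "\<sigma> * (1 / q - 1 / p) * t \<le> \<bar>t\<bar>" by simp
    show "1 / 16 * t\<^sup>2 \<le> (\<phi> - 2) * \<sigma>\<^sup>2 / (2 * ?s\<^sup>2) * t\<^sup>2"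
      using quad by (intro mult_right_mono) auto
  qed
  also have "\<dots> \<le> 8 + - t\<^sup>2 / 32"
  proof -
    \<comment> \<open>Divided by 32, this says \<open>\<bar>t\<bar> \<le> 8 + t^2 / 32\<close>: half
      of the quadratic term absorbs the linear one, at the cost of the constant 8.\<close>
    have "0 \<le> (\<bar>t\<bar> - 16)\<^sup>2" by simp
    then show ?thesis by (simp add: power2_diff)
  qed
  finally have "exp (a * ln (1 + \<sigma> * t / p) + b * ln (1 - \<sigma> * t / q)) \<le> exp (8 + - t\<^sup>2 / 32)"
    by simp
  moreover have "beta_kernel m \<sigma> u t = exp (a * ln (1 + \<sigma> * t / p) + b * ln (1 - \<sigma> * t / q))"
    using True pos unfolding p_def q_def \<phi>_def a_def b_def
    by (simp add: beta_kernel_def Let_def powr_def exp_add)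
  ultimately show ?thesis
    by (simp only: exp_add)
next
  case False
  then show ?thesis
    by (auto simp: beta_kernel_def Let_def p_def q_def)
qed

text \<open>The quantifier over \<open>t\<close> stands inside: one threshold for \<open>u\<close>
  serves all \<open>t\<close>, as dominated convergence requires.\<close>

lemma eventually_beta_kernel_le:
  fixes m \<sigma> :: real
  assumes "0 < \<sigma>"
  shows "\<forall>\<^sub>F u in at_top. \<forall>t. beta_kernel m \<sigma> u t \<le> exp 8 * exp (- t\<^sup>2 / 32)"
proof -
  have lin: "((\<lambda>u. \<sigma> * (1 / (1 + u - m) - 1 / (u + m))) \<longlongrightarrow> 0) at_top"
    using assms by real_asymp
  \<comment> \<open>Here \<open>\<phi> * \<sigma>^2\<close> grows like \<open>u^2\<close> and the
    denominator like \<open>8 * u^2\<close>. The limit \<open>1 / 8\<close> leaves room for the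
    bound \<open>1 / 16\<close>.\<close>
  have quad: "((\<lambda>u. (((u + m) * (1 + u - m) / \<sigma>\<^sup>2 - 1) - 2) * \<sigma>\<^sup>2 / (2 * (1 + 2 * u)\<^sup>2)) \<longlongrightarrow> 1 / 8) at_top"
    using assms by (real_asymp simp: field_simps power2_eq_square)
  have a: "filterlim (\<lambda>u. (u + m) / (1 + 2 * u) * ((u + m) * (1 + u - m) / \<sigma>\<^sup>2 - 1)) at_top at_top"
    using assms by (real_asymp simp: field_simps power2_eq_square)
  have b: "filterlim (\<lambda>u. (1 + u - m) / (1 + 2 * u) * ((u + m) * (1 + u - m) / \<sigma>\<^sup>2 - 1)) at_top at_top"
    using assms by (real_asymp simp: field_simps power2_eq_square)
  have "\<forall>\<^sub>F u in at_top. \<bar>\<sigma> * (1 / (1 + u - m) - 1 / (u + m))\<bar> < 1"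
    using tendstoD[OF lin, of 1] by (simp add: dist_real_def)
  moreover have "\<forall>\<^sub>F u in at_top. 1 / 16 < (((u + m) * (1 + u - m) / \<sigma>\<^sup>2 - 1) - 2) * \<sigma>\<^sup>2 / (2 * (1 + 2 * u)\<^sup>2)"
    using quad by (rule order_tendstoD) simp
  moreover have "\<forall>\<^sub>F u in at_top. 1 \<le> (u + m) / (1 + 2 * u) * ((u + m) * (1 + u - m) / \<sigma>\<^sup>2 - 1)"
    using a by (simp add: filterlim_at_top)
  moreover have "\<forall>\<^sub>F u in at_top. 1 \<le> (1 + u - m) / (1 + 2 * u) * ((u + m) * (1 + u - m) / \<sigma>\<^sup>2 - 1)"
    using b by (simp add: filterlim_at_top)
  moreover have "\<forall>\<^sub>F u in at_top. \<bar>m\<bar> + 1 < u"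
    by (rule eventually_gt_at_top)
  ultimately show ?thesis
  proof eventually_elim
    case (elim u)
    then show ?case
      by (intro allI beta_kernel_le) linarith+
  qed
qed

section \<open>Convergence of kernel integrals\<close>

lemma integrable_exp_neg_square_divide:
  fixes c :: real
  assumes "0 < c"
  shows "integrable lborel (\<lambda>t. exp (- t\<^sup>2 / (2 * c\<^sup>2)))"
proof -
  have "exp (- t\<^sup>2 / (2 * c\<^sup>2)) = sqrt (2 * pi * c\<^sup>2) * normal_density 0 c t" for t
    using assms by (simp add: normal_density_def)
  then show ?thesis
    by (simp only:) (rule integrable_mult_right, rule integrable_normal_density[OF assms])
qed

text \<open>The set \<open>A\<close> is a half-line for the numerator of the distribution function
  and \<open>UNIV\<close> for its denominator.\<close>

lemma tendsto_integral_beta_kernel: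
  fixes m \<sigma> :: real
  assumes "0 < \<sigma>" and A [measurable]: "A \<in> sets borel"
  shows "((\<lambda>u. \<integral>t. beta_kernel m \<sigma> u t * indicator A t \<partial>lborel) \<longlongrightarrow>
    (\<integral>t. exp (- t\<^sup>2 / 2) * indicator A t \<partial>lborel)) at_top"
proof (rule integral_dominated_convergence_at_top)
  show "integrable lborel (\<lambda>t::real. exp 8 * exp (- t\<^sup>2 / 32))"
    \<comment> \<open>The dominating Gaussian has standard deviation 4, since
      \<open>2 * 4^2 = 32\<close>.\<close>
    using integrable_exp_neg_square_divide[of 4] by simp
  show "\<forall>\<^sub>F u in at_top. AE t in lborel. norm (beta_kernel m \<sigma> u t * indicator A t) \<le> exp 8 * exp (- t\<^sup>2 / 32)"
    using eventually_beta_kernel_le[OF assms(1), of m]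
  proof eventually_elim
    case (elim u)
    moreover have "0 \<le> beta_kernel m \<sigma> u t" for t
      by (simp add: beta_kernel_def Let_def)
    ultimately show ?case
      by (intro AE_I2) (auto simp: indicator_def)
  qed
  show "AE t in lborel. ((\<lambda>u. beta_kernel m \<sigma> u t * indicator A t) \<longlongrightarrow> exp (- t\<^sup>2 / 2) * indicator A t) at_top"
    using assms(1) by (intro AE_I2 tendsto_mult tendsto_beta_kernel tendsto_const)
qed measurable

section \<open>Distribution functions and the normal limit\<close>

text \<open>The map \<open>g\<close> lets one formula cover the beta variable (identity) and the
  affine image of \<open>Z\<close>.\<close>

lemma cdf_distr_eq_integral:
  fixes X :: "'a \<Rightarrow> real" and f :: "real \<Rightarrow> real"
  assumes X: "distributed M lborel X f" and "\<And>x. 0 \<le> f x" and g [measurable]: "g \<in> borel_measurable borel"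
  shows "cdf (distr M borel (\<lambda>\<omega>. g (X \<omega>))) x = (\<integral>y. f y * indicator {..x} (g y) \<partial>lborel)"
proof -
  have [measurable]: "X \<in> borel_measurable M"
    using distributed_measurable[OF X] by simp
  have "cdf (distr M borel (\<lambda>\<omega>. g (X \<omega>))) x = (\<integral>y. indicator {..x} y \<partial>distr M borel (\<lambda>\<omega>. g (X \<omega>)))"
    unfolding cdf_def by simp
  also have "\<dots> = (\<integral>\<omega>. indicator {..x} (g (X \<omega>)) \<partial>M)"
    by (rule integral_distr) measurable
  also have "\<dots> = (\<integral>y. f y * indicator {..x} (g y) \<partial>lborel)"
    using assms by (intro distributed_integral [symmetric, OF X]) auto
  finally show ?thesis .
qed

text \<open>After \<open>y = m + \<sigma> * t\<close>, both the total mass and the distribution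
  function carry the factor \<open>\<sigma> * K\<close>. Total mass 1 identifies this factor as the
  reciprocal of the kernel's full integral.\<close>

lemma cdf_beta4_eq_kernel_ratio:
  assumes "0 < \<sigma>" "0 \<le> u" and par: "0 < \<mu>" "\<mu> < 1" "0 < \<phi>" and M: "prob_space M"
    and Y: "distributed M lborel Y (beta4_density \<mu> \<phi> (- u) (1 + u))"
    and mean: "prob_space.expectation M Y = m"
    and var: "prob_space.variance M Y = \<sigma>\<^sup>2"
  shows "cdf (distr M borel Y) x =
    (\<integral>t. beta_kernel m \<sigma> u t * indicator {t. m + \<sigma> * t \<le> x} t \<partial>lborel) /
    (\<integral>t. beta_kernel m \<sigma> u t * indicator UNIV t \<partial>lborel)"
proof -
  have u12: "- u < 1 + u"
    using assms(2) by simp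
  have \<mu>: "m = - u + (1 + 2 * u) * \<mu>"
    using beta4_mean[OF par u12 Y] mean by simp
  have \<phi>: "\<sigma>\<^sup>2 = (1 + 2 * u)\<^sup>2 * (\<mu> * (1 - \<mu>)) / (\<phi> + 1)"
    using beta4_variance[OF par u12 Y] beta4_mean[OF par u12 Y] var by (simp add: add.commute)
  have p: "0 < u + m" and q: "0 < 1 + u - m"
  proof -
    have "u + m = (1 + 2 * u) * \<mu>" "1 + u - m = (1 + 2 * u) * (1 - \<mu>)"
      by (auto simp: \<mu> algebra_simps)
    then show "0 < u + m" "0 < 1 + u - m"
      using par assms(2) by simp_all
  qed
  obtain K where K: "\<And>t. beta4_density \<mu> \<phi> (- u) (1 + u) (m + \<sigma> * t) = K * beta_kernel m \<sigma> u t"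
    using beta4_density_eq_beta_kernel[OF p q assms(1) \<mu> par(3) \<phi>] by metis
  \<comment> \<open>\<open>B\<close> is kept free: \<open>UNIV\<close> yields the normalisation,
    \<open>{..x}\<close> the distribution function.\<close>
  have subst: "(\<integral>y. beta4_density \<mu> \<phi> (- u) (1 + u) y * indicator B y \<partial>lborel) =
      \<sigma> * K * (\<integral>t. beta_kernel m \<sigma> u t * indicator {t. m + \<sigma> * t \<in> B} t \<partial>lborel)" for B
    using assms(1)
    by (subst lborel_integral_real_affine[where c = \<sigma> and t = m])
      (simp_all add: K indicator_def of_bool_def if_distrib mult.assoc flip: integral_mult_right_zero cong: if_cong)
  have "(\<integral>y. beta4_density \<mu> \<phi> (- u) (1 + u) y * 1 \<partial>lborel) = (\<integral>\<omega>. 1 \<partial>M)"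
    by (intro distributed_integral[OF Y] beta4_density_nonneg par u12) simp
  then have "\<sigma> * K * (\<integral>t. beta_kernel m \<sigma> u t * indicator UNIV t \<partial>lborel) = 1"
    using subst[of UNIV] prob_space.prob_space[OF M] by simp
  moreover have "cdf (distr M borel Y) x =
      \<sigma> * K * (\<integral>t. beta_kernel m \<sigma> u t * indicator {t. m + \<sigma> * t \<le> x} t \<partial>lborel)"
    using cdf_distr_eq_integral[OF Y beta4_density_nonneg[OF par u12], of "\<lambda>y. y" x] subst[of "{..x}"]
    by simp
  ultimately show ?thesis
    by (metis mult_zero_right nonzero_mult_div_cancel_left nonzero_mult_divide_mult_cancel_left
        div_by_1 zero_neq_one mult_eq_0_iff)
qed

lemma beta4_conv_in_distribution_normal:
  fixes m \<sigma> :: real and \<mu> \<phi> :: "real \<Rightarrow> real" and Y :: "real \<Rightarrow> 'b \<Rightarrow> real" and Z :: "'c \<Rightarrow> real"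
  assumes "0 < \<sigma>"
    and Y: "\<forall>\<^sub>F u in at_top.
           0 < \<mu> u \<and> \<mu> u < 1 \<and> 0 < \<phi> u \<and> prob_space (M u) \<and>
           distributed (M u) lborel (Y u) (beta4_density (\<mu> u) (\<phi> u) (- u) (1 + u)) \<and>
           prob_space.expectation (M u) (Y u) = m \<and>
           prob_space.variance (M u) (Y u) = \<sigma>\<^sup>2"
    and Z: "distributed N lborel Z std_normal_density"
  shows "conv_in_distribution M Y N (\<lambda>\<omega>. m + \<sigma> * Z \<omega>) at_top"
  unfolding conv_in_distribution_def
proof (intro allI impI)
  fix x
  let ?A = "{t. m + \<sigma> * t \<le> x}"
  have A: "?A \<in> sets borel"
    by measurable
  have std: "std_normal_density t = exp (- t\<^sup>2 / 2) / sqrt (2 * pi)" for t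
    by (simp add: std_normal_density_def)
  have total: "(\<integral>t. exp (- t\<^sup>2 / 2) * indicator UNIV t \<partial>lborel) = sqrt (2 * pi)"
  proof -
    have "exp (- t\<^sup>2 / 2) = sqrt (2 * pi) * std_normal_density t" for t :: real
      by (simp add: std_normal_density_def)
    then show ?thesis by simp
  qed
  have "cdf (distr N borel (\<lambda>\<omega>. m + \<sigma> * Z \<omega>)) x
      = (\<integral>t. std_normal_density t * indicator {..x} (m + \<sigma> * t) \<partial>lborel)"
    using cdf_distr_eq_integral[OF Z, of "\<lambda>t. m + \<sigma> * t" x] by simp
  also have "\<dots> = (\<integral>t. exp (- t\<^sup>2 / 2) * indicator ?A t / sqrt (2 * pi) \<partial>lborel)"
    by (intro Bochner_Integration.integral_cong refl) (simp add: std indicator_def)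
  also have "\<dots> = (\<integral>t. exp (- t\<^sup>2 / 2) * indicator ?A t \<partial>lborel) / sqrt (2 * pi)"
    by simp
  finally have lim: "(\<integral>t. exp (- t\<^sup>2 / 2) * indicator ?A t \<partial>lborel) /
      (\<integral>t. exp (- t\<^sup>2 / 2) * indicator UNIV t \<partial>lborel) = cdf (distr N borel (\<lambda>\<omega>. m + \<sigma> * Z \<omega>)) x"
    unfolding total by simp
  have "((\<lambda>u. (\<integral>t. beta_kernel m \<sigma> u t * indicator ?A t \<partial>lborel) /
      (\<integral>t. beta_kernel m \<sigma> u t * indicator UNIV t \<partial>lborel)) \<longlongrightarrow>
      cdf (distr N borel (\<lambda>\<omega>. m + \<sigma> * Z \<omega>)) x) at_top"
    \<comment> \<open>The quotient rule applies because the limit of the denominator is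
      \<open>sqrt (2 * pi)\<close>, which is nonzero.\<close>
    unfolding lim [symmetric] using assms(1) A
    by (intro tendsto_divide tendsto_integral_beta_kernel) (simp_all only: total, simp_all)
  moreover have "\<forall>\<^sub>F u in at_top. (\<integral>t. beta_kernel m \<sigma> u t * indicator ?A t \<partial>lborel) /
      (\<integral>t. beta_kernel m \<sigma> u t * indicator UNIV t \<partial>lborel) = cdf (distr (M u) borel (Y u)) x"
    using Y eventually_ge_at_top[of 0]
    by eventually_elim (use assms(1) in \<open>blast intro: cdf_beta4_eq_kernel_ratio [symmetric]\<close>)
  ultimately show "((\<lambda>u. cdf (distr (M u) borel (Y u)) x) \<longlongrightarrow>
      cdf (distr N borel (\<lambda>\<omega>. m + \<sigma> * Z \<omega>)) x) at_top"
    by (rule Lim_transform_eventually)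
qed

theorem theorem1:
  shows
    "(\<forall>(\<mu>::real) (\<phi>::real) (u::real) (M :: 'a measure) (Y :: 'a \<Rightarrow> real).
        0 < \<mu> \<and> \<mu> < 1 \<and> 0 < \<phi> \<and> 0 \<le> u \<and> prob_space M \<and>
        distributed M lborel Y (beta4_density \<mu> \<phi> (- u) (1 + u)) \<longrightarrow>
        u = 0 \<longrightarrow>
        distributed M lborel Y (beta_density \<mu> \<phi>)) \<and>
     (\<forall>(\<mu>s::real) (\<sigma>s::real) (\<mu> :: real \<Rightarrow> real) (\<phi> :: real \<Rightarrow> real)
         (M :: real \<Rightarrow> 'b measure) (Y :: real \<Rightarrow> 'b \<Rightarrow> real)
         (N :: 'c measure) (Z :: 'c \<Rightarrow> real).
        0 < \<sigma>s \<and>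
        (\<forall>\<^sub>F u in at_top.
           0 < \<mu> u \<and> \<mu> u < 1 \<and> 0 < \<phi> u \<and> prob_space (M u) \<and>
           distributed (M u) lborel (Y u) (beta4_density (\<mu> u) (\<phi> u) (- u) (1 + u)) \<and>
           prob_space.expectation (M u) (Y u) = \<mu>s \<and>
           prob_space.variance (M u) (Y u) = \<sigma>s\<^sup>2) \<and>
        prob_space N \<and> distributed N lborel Z std_normal_density \<longrightarrow>
        conv_in_distribution M Y N (\<lambda>\<omega>. \<mu>s + \<sigma>s * Z \<omega>) at_top)"
proof (intro conjI allI impI; elim conjE)
  fix \<mu> \<phi> u :: real and M :: "'a measure" and Y :: "'a \<Rightarrow> real"
  assume "distributed M lborel Y (beta4_density \<mu> \<phi> (- u) (1 + u))" "u = 0"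
  then show "distributed M lborel Y (beta_density \<mu> \<phi>)"
    by (simp add: beta4_density_def)
qed (rule beta4_conv_in_distribution_normal)

end
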